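(* Let $n\ge 2$ and let $f\colon\mathbb{R}^n\to\mathbb{R}$ be a real analytic function whose graph $G_f=\{(x,f(x))\,;\,x\in\mathbb{R}^n\}$ is a constant mean curvature graph in the Lorentz-Minkowski space $\mathbb{R}^{n+1}_1$, i.e. there is a constant $k\in\mathbb{R}$ such that $A_f^2-kB_f^3=0$ identically on $\mathbb{R}^n$. If $G_f$ has no time-like points (i.e. $B_f\ge 0$ on $\mathbb{R}^n$) and has at least one light-like point (i.e. $B_f(x)=0$ for some $x\in\mathbb{R}^n$), then $G_f$ is a light-like hyperplane in $\mathbb{R}^{n+1}_1$.
   Context: $\mathbb{R}^{n+1}_1$ ($n\ge 2$) denotes the Lorentz-Minkowski $(n+1)$-space of signature $(+\cdots+-)$, i.e. $\mathbb{R}^{n+1}$ with the inner product $x_1y_1+\cdots+x_ny_n-x_{n+1}y_{n+1}$. For a function $f$ of class at least $C^2$ on a domain $\Omega\subset\mathbb{R}^n$, with $f_{x_i}=\partial f/\partial x_i$, $f_{x_i,x_j}=\partial^2 f/\partial x_i\partial x_j$ and $\delta_{i,j}$ the Kronecker delta, put $$B_f:=1-f_{x_1}^2-\cdots-f_{x_n}^2,\qquad A_f:=\sum_{i,j=1}^n (B_f\delta_{i,j}+f_{x_i}f_{x_j})f_{x_i,x_j}.$$ The graph $G_f=\{(x,f(x))\in\mathbb{R}^{n+1}_1\,;\,x\in\Omega\}$ is called a constant mean curvature graph (CMC-graph) if $A_f^2-kB_f^3$ vanishes identically on $\Omega$ for a certain constant $k\in\mathbb{R}$, and is called entire if $\Omega=\mathbb{R}^n$.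 A point of $\Omega$ where $B_f>0$ (resp. $B_f<0$, $B_f=0$) is called a space-like (resp. time-like, light-like) point of $G_f$. A light-like hyperplane is an affine hyperplane of $\mathbb{R}^{n+1}$ on which the induced metric is degenerate. *)

theory Defs
  imports "HOL-Analysis.Analysis"
begin

text \<open>
  Real analyticity in several variables: locally the sum of a convergent power series. The multi-indices
  are the functions from the finite index type \<open>'n\<close> to \<open>nat\<close>, and the sum over all of them is unordered
  (equivalently, absolutely convergent). The set \<open>U\<close> is meant to be open.
\<close>

definition real_analytic_on :: "(real ^ 'n \<Rightarrow> real) \<Rightarrow> (real ^ 'n) set \<Rightarrow> bool"
  where "real_analytic_on f U \<longleftrightarrow>
    (\<forall>p\<in>U. \<exists>c :: ('n \<Rightarrow> nat) \<Rightarrow> real. \<exists>r>0. \<forall>x\<in>ball p r.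
       ((\<lambda>\<alpha>. c \<alpha> * (\<Prod>i\<in>UNIV. (x $ i - p $ i) ^ \<alpha> i)) has_sum f x) UNIV)"

text \<open>The value of a partial derivative is arbitrary (as for \<open>deriv\<close>) where it does not exist.\<close>

definition partial_deriv :: "'n \<Rightarrow> (real ^ 'n \<Rightarrow> real) \<Rightarrow> real ^ 'n \<Rightarrow> real"
  where "partial_deriv i f x = deriv (\<lambda>t. f (x + t *\<^sub>R axis i 1)) 0"

text \<open>
  Lorentz-Minkowski space of signature \<open>(+\<cdots>+-)\<close> is the product \<open>(real ^ 'n) \<times> real\<close>, the second
  factor being the last, time-like, coordinate.
\<close>

definition lorentz :: "(real ^ 'n) \<times> real \<Rightarrow> (real ^ 'n) \<times> real \<Rightarrow> real"
  where "lorentz v w = (\<Sum>i\<in>UNIV. fst v $ i * fst w $ i) - snd v * snd w"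

definition B_fun :: "(real ^ 'n \<Rightarrow> real) \<Rightarrow> real ^ 'n \<Rightarrow> real"
  where "B_fun f x = 1 - (\<Sum>i\<in>UNIV. (partial_deriv i f x)\<^sup>2)"

definition A_fun :: "(real ^ 'n \<Rightarrow> real) \<Rightarrow> real ^ 'n \<Rightarrow> real"
  where "A_fun f x = (\<Sum>i\<in>UNIV. \<Sum>j\<in>UNIV.
    (B_fun f x * (if i = j then 1 else 0) + partial_deriv i f x * partial_deriv j f x)
      * partial_deriv i (partial_deriv j f) x)"

definition graph_over :: "(real ^ 'n) set \<Rightarrow> (real ^ 'n \<Rightarrow> real) \<Rightarrow> ((real ^ 'n) \<times> real) set"
  where "graph_over \<Omega> f = {(x, f x) | x. x \<in> \<Omega>}"

text \<open>
  The following notions are meant for \<open>f\<close> of class at least \<open>C\<^sup>2\<close> on a domain \<open>\<Omega>\<close>; this regularity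
  is not part of the definitions. An entire graph is one with \<open>\<Omega> = UNIV\<close>. A point of the graph is
  identified with its projection \<open>x\<close> to \<open>\<Omega>\<close>.
\<close>

definition cmc_graph :: "(real ^ 'n) set \<Rightarrow> (real ^ 'n \<Rightarrow> real) \<Rightarrow> bool"
  where "cmc_graph \<Omega> f \<longleftrightarrow> (\<exists>k::real. \<forall>x\<in>\<Omega>. (A_fun f x)\<^sup>2 - k * (B_fun f x) ^ 3 = 0)"

definition time_like_point :: "(real ^ 'n \<Rightarrow> real) \<Rightarrow> real ^ 'n \<Rightarrow> bool"
  where "time_like_point f x \<longleftrightarrow> B_fun f x < 0"

definition light_like_point :: "(real ^ 'n \<Rightarrow> real) \<Rightarrow> real ^ 'n \<Rightarrow> bool"
  where "light_like_point f x \<longleftrightarrow> B_fun f x = 0"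

text \<open>
  The induced metric is the restriction of \<open>lorentz\<close> to the direction space \<open>V\<close> of the hyperplane;
  it is degenerate if some nonzero vector of \<open>V\<close> is orthogonal to all of \<open>V\<close>.
\<close>

definition light_like_hyperplane :: "((real ^ 'n) \<times> real) set \<Rightarrow> bool"
  where "light_like_hyperplane H \<longleftrightarrow>
    affine H \<and> aff_dim H = int DIM((real ^ 'n) \<times> real) - 1 \<and>
    (let V = {p - q | p q. p \<in> H \<and> q \<in> H}
     in \<exists>v\<in>V. v \<noteq> 0 \<and> (\<forall>w\<in>V. lorentz v w = 0))"

end

theory Submission
  imports Defs
begin

text \<open>
  Since \<open>B = 1 - |\<nabla>f|\<^sup>2 \<ge> 0\<close>, the function \<open>f\<close> is 1-Lipschitz. Let \<open>B\<close> vanish at \<open>p\<close> and put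
  \<open>v = \<nabla>f(p)\<close>, a unit vector. The crucial claim is that \<open>f\<close> has slope exactly 1 along the whole line
  \<open>p + t v\<close> (lemma \<open>deriv_along_light_like_line\<close>), i.e. the graph contains a complete light-like line.
  A 1-Lipschitz function that attains the extreme slope along a complete line is affine
  (lemma \<open>lipschitz_with_unit_slope_line_affine\<close>): the bounds \<open>f(x) \<le> f(p + t v) + |x - p - t v|\<close> for
  \<open>t \<rightarrow> -\<infinity>\<close> and \<open>f(x) \<ge> f(p + t v) - |x - p - t v|\<close> for \<open>t \<rightarrow> \<infinity>\<close> squeeze \<open>f(x)\<close> to
  \<open>f(p) + \<langle>x - p, v\<rangle>\<close>, and the graph of this function is a light-like hyperplane.

  For the claim, consider the defect \<open>u(t) = 1 - \<langle>v, \<nabla>f(p + t v)\<rangle>\<close>. As \<open>|v| = 1\<close>, it satisfies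
  \<open>2 u = B + |\<nabla>f - v|\<^sup>2\<close>, so \<open>u \<ge> 0\<close>, and \<open>u(0) = 0\<close>. Its derivative is \<open>- Hess f (v, v)\<close>. Writing
  \<open>v = \<nabla>f - g\<close> and using \<open>\<nabla>B = -2 Hess f \<nabla>f\<close> and \<open>A = B \<Delta>f + Hess f (\<nabla>f, \<nabla>f)\<close> gives
  \<open>Hess f (v, v) = A - B \<Delta>f + \<langle>g, \<nabla>B\<rangle> + Hess f (g, g)\<close>.
  On bounded sets every summand is \<open>O(B + |g|\<^sup>2) = O(u)\<close>: the equation \<open>A\<^sup>2 = k B\<^sup>3\<close> with
  \<open>0 \<le> B \<le> 1\<close> gives \<open>A = O(B)\<close>, and a nonnegative \<open>C\<^sup>2\<close> function satisfies \<open>|\<nabla>B|\<^sup>2 = O(B)\<close>. Hence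
  \<open>|u'| \<le> L u\<close> on bounded intervals, and Gronwall's lemma gives \<open>u = 0\<close>.

  Analyticity supplies the regularity: partial derivatives of analytic functions exist, are
  analytic, and commute, by termwise differentiation of the power series.
\<close>

section \<open>Termwise differentiation of power series in several variables\<close>

definition has_power_series ::
    "(real ^ 'n \<Rightarrow> real) \<Rightarrow> (('n \<Rightarrow> nat) \<Rightarrow> real) \<Rightarrow> real ^ 'n \<Rightarrow> real \<Rightarrow> bool"
  where "has_power_series F c p r \<longleftrightarrow>
    (\<forall>x\<in>ball p r. ((\<lambda>\<alpha>. c \<alpha> * (\<Prod>i\<in>UNIV. (x $ i - p $ i) ^ \<alpha> i)) has_sum F x) UNIV)"

definition diff_coeffs :: "'n \<Rightarrow> (('n \<Rightarrow> nat) \<Rightarrow> real) \<Rightarrow> ('n \<Rightarrow> nat) \<Rightarrow> real"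
  where "diff_coeffs i c \<alpha> = real (\<alpha> i + 1) * c (\<alpha>(i := \<alpha> i + 1))"

lemma real_analytic_on_iff:
  "real_analytic_on F U \<longleftrightarrow> (\<forall>p\<in>U. \<exists>c. \<exists>r>0. has_power_series F c p r)"
  by (simp add: real_analytic_on_def has_power_series_def)

text \<open>
  For \<open>\<alpha> i = 0\<close> the truncated exponent is harmless because of the factor \<open>\<alpha> i\<close>.
\<close>

definition monom_deriv :: "'n::finite \<Rightarrow> ('n \<Rightarrow> nat) \<Rightarrow> real ^ 'n \<Rightarrow> real"
  where "monom_deriv i \<alpha> y =
    real (\<alpha> i) * y $ i ^ (\<alpha> i - 1) * (\<Prod>j\<in>UNIV - {i}. y $ j ^ \<alpha> j)"

lemma has_derivative_monom:
  fixes p :: "real ^ 'n"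
  shows "((\<lambda>x. \<Prod>i\<in>UNIV. (x $ i - p $ i) ^ \<alpha> i) has_derivative
     (\<lambda>h. \<Sum>i\<in>UNIV. h $ i * monom_deriv i \<alpha> (x - p))) (at x within S)"
proof (rule has_derivative_eq_rhs, rule has_derivative_prod)
  show "((\<lambda>x. (x $ i - p $ i) ^ \<alpha> i) has_derivative
      (\<lambda>h. real (\<alpha> i) * (x $ i - p $ i) ^ (\<alpha> i - 1) * h $ i)) (at x within S)" for i
    by (auto intro!: derivative_eq_intros bounded_linear.has_derivative[OF bounded_linear_vec_nth]
        simp: fun_eq_iff)
qed (auto simp: fun_eq_iff monom_deriv_def algebra_simps intro!: sum.cong)

text \<open>
  Halving the polydisc radius absorbs the factor produced by differentiation, since
  \<open>m \<le> 2 ^ (m - 1)\<close> for \<open>m \<ge> 1\<close>. This turns the absolutely convergent series at the corner of the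
  polydisc of radius \<open>\<rho>\<close> into a majorant for all differentiated series.
\<close>

lemma monom_deriv_bound:
  fixes y :: "real ^ 'n"
  assumes "\<rho> > 0" and y: "\<And>j. \<bar>y $ j\<bar> \<le> \<rho> / 2"
  shows "\<bar>monom_deriv i \<alpha> y\<bar> \<le> (\<Prod>j\<in>UNIV. \<rho> ^ \<alpha> j) / \<rho>"
proof -
  have "real m * \<bar>y $ i\<bar> ^ (m - 1) \<le> \<rho> ^ m / \<rho>" for m
  proof (cases m)
    case (Suc k)
    have "real (Suc k) \<le> 2 ^ k"
      by (induction k) auto
    hence "real m * (\<rho> / 2) ^ k \<le> \<rho> ^ k"
      using Suc \<open>\<rho> > 0\<close> by (simp add: power_divide divide_simps mult.commute)
    moreover have "\<bar>y $ i\<bar> ^ k \<le> (\<rho> / 2) ^ k"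
      by (intro power_mono y) auto
    hence "real m * \<bar>y $ i\<bar> ^ k \<le> real m * (\<rho> / 2) ^ k"
      by (intro mult_left_mono) auto
    ultimately have "real m * \<bar>y $ i\<bar> ^ k \<le> \<rho> ^ k"
      by linarith
    thus ?thesis
      using Suc \<open>\<rho> > 0\<close> by simp
  qed (use \<open>\<rho> > 0\<close> in auto)
  moreover have "(\<Prod>j\<in>UNIV - {i}. \<bar>y $ j\<bar> ^ \<alpha> j) \<le> (\<Prod>j\<in>UNIV - {i}. \<rho> ^ \<alpha> j)"
  proof (intro prod_mono conjI power_mono)
    show "\<bar>y $ j\<bar> \<le> \<rho>" for j
      using y[of j] \<open>\<rho> > 0\<close> by linarith
  qed auto
  ultimately have "real (\<alpha> i) * \<bar>y $ i\<bar> ^ (\<alpha> i - 1) * (\<Prod>j\<in>UNIV - {i}. \<bar>y $ j\<bar> ^ \<alpha> j)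
      \<le> \<rho> ^ \<alpha> i / \<rho> * (\<Prod>j\<in>UNIV - {i}. \<rho> ^ \<alpha> j)"
    using \<open>\<rho> > 0\<close> by (intro mult_mono prod_nonneg) auto
  also have "\<dots> = (\<Prod>j\<in>UNIV. \<rho> ^ \<alpha> j) / \<rho>"
    by (subst prod.remove[of UNIV i]) auto
  finally show ?thesis
    by (simp add: monom_deriv_def abs_mult abs_prod power_abs)
qed

text \<open>
  The index shift that puts the differentiated series back into power series form; the multi-indices
  with \<open>\<alpha> i = 0\<close> drop out because their derivative vanishes.
\<close>

lemma has_sum_diff_coeffs:
  fixes p x :: "real ^ 'n"
  assumes "((\<lambda>\<alpha>. c \<alpha> * monom_deriv i \<alpha> (x - p)) has_sum s) UNIV"
  shows "((\<lambda>\<alpha>. diff_coeffs i c \<alpha> * (\<Prod>i\<in>UNIV. (x $ i - p $ i) ^ \<alpha> i)) has_sum s) UNIV"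
proof -
  define up where "up = (\<lambda>\<alpha>::'n \<Rightarrow> nat. \<alpha>(i := \<alpha> i + 1))"
  have inj: "inj up"
  proof (rule injI)
    fix \<alpha> \<beta> assume e: "up \<alpha> = up \<beta>"
    show "\<alpha> = \<beta>"
    proof
      fix j show "\<alpha> j = \<beta> j"
        using fun_cong[OF e, of j] by (cases "j = i") (auto simp: up_def)
    qed
  qed
  have "((\<lambda>\<alpha>. c \<alpha> * monom_deriv i \<alpha> (x - p)) has_sum s) (range up)"
  proof (rule has_sum_cong_neutral[THEN iffD1, OF _ _ _ assms])
    fix \<alpha> :: "'n \<Rightarrow> nat" assume "\<alpha> \<in> UNIV - range up"
    have "\<alpha> i = 0"
    proof (rule ccontr)
      assume "\<alpha> i \<noteq> 0"
      hence "\<alpha> = up (\<alpha>(i := \<alpha> i - 1))"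
        by (auto simp: up_def)
      with \<open>\<alpha> \<in> UNIV - range up\<close> show False by blast
    qed
    thus "c \<alpha> * monom_deriv i \<alpha> (x - p) = 0"
      by (simp add: monom_deriv_def)
  qed auto
  hence "((\<lambda>\<alpha>. c (up \<alpha>) * monom_deriv i (up \<alpha>) (x - p)) has_sum s) UNIV"
    using has_sum_reindex[OF inj, THEN iffD1] by (fastforce simp: o_def)
  moreover have "c (up \<alpha>) * monom_deriv i (up \<alpha>) (x - p)
      = diff_coeffs i c \<alpha> * (\<Prod>i\<in>UNIV. (x $ i - p $ i) ^ \<alpha> i)" for \<alpha>
  proof -
    have "(\<Prod>j\<in>UNIV - {i}. (x - p) $ j ^ up \<alpha> j) = (\<Prod>j\<in>UNIV - {i}. (x $ j - p $ j) ^ \<alpha> j)"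
      by (rule prod.cong) (auto simp: up_def)
    thus ?thesis
      by (subst prod.remove[of UNIV i]) (auto simp: monom_deriv_def diff_coeffs_def up_def)
  qed
  ultimately show ?thesis by simp
qed

text \<open>
  An enumeration of the multi-indices reduces the claim to the theorem on differentiation of series
  of functions indexed by the natural numbers; uniform convergence of the derivatives is the
  Weierstrass M-test with the majorant of \<open>monom_deriv_bound\<close>.
\<close>

lemma has_power_series_termwise_deriv:
  fixes p :: "real ^ 'n"
  assumes "has_power_series F c p r" "r > 0"
  obtains \<rho> where "\<rho> > 0"
    "\<And>x i. x \<in> ball p \<rho> \<Longrightarrow> (\<lambda>\<alpha>. c \<alpha> * monom_deriv i \<alpha> (x - p)) summable_on UNIV"
    "\<And>x. x \<in> ball p \<rho> \<Longrightarrow> (F has_derivative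
      (\<lambda>h. \<Sum>i\<in>UNIV. h $ i * (\<Sum>\<^sub>\<infinity>\<alpha>. c \<alpha> * monom_deriv i \<alpha> (x - p)))) (at x)"
proof -
  define \<rho> where "\<rho> = r / (2 * CARD('n))"
  have \<rho>: "\<rho> > 0" using \<open>r > 0\<close> by (simp add: \<rho>_def)
  have "\<rho> \<le> r / 1" unfolding \<rho>_def
    using \<open>r > 0\<close> zero_less_card_finite[where 'a='n] by (intro divide_left_mono) linarith+
  hence "\<rho> \<le> r" by simp
  \<comment> \<open>The factor \<open>CARD('n)\<close> in \<open>\<rho>\<close> keeps this corner of the cube inside the ball of convergence.\<close>
  define q where "q = p + (\<chi> i. \<rho>)"
  have "norm ((\<chi> i. \<rho>) :: real ^ 'n) \<le> CARD('n) * \<rho>"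
    using norm_le_l1_cart[of "(\<chi> i. \<rho>) :: real ^ 'n"] \<rho> by simp
  also have "\<dots> < r" using \<open>r > 0\<close> by (simp add: \<rho>_def)
  finally have "q \<in> ball p r" by (simp add: q_def dist_norm)
  hence "((\<lambda>\<alpha>. c \<alpha> * (\<Prod>i\<in>UNIV. \<rho> ^ \<alpha> i)) has_sum F q) UNIV"
    using assms(1) by (force simp: has_power_series_def q_def)
  hence "(\<lambda>\<alpha>. \<bar>c \<alpha> * (\<Prod>i\<in>UNIV. \<rho> ^ \<alpha> i)\<bar>) summable_on UNIV"
    using summable_on_iff_abs_summable_on_real has_sum_imp_summable by fastforce
  hence M: "(\<lambda>\<alpha>. \<bar>c \<alpha>\<bar> * (\<Prod>i\<in>UNIV. \<rho> ^ \<alpha> i) / \<rho>) summable_on UNIV"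
    (is "?M summable_on UNIV")
    using \<rho> summable_on_cmult_left[of _ UNIV "1 / \<rho>"]
    by (simp add: abs_mult abs_prod power_abs)
  define S where "S = ball p (\<rho> / 2)"
  have bound: "norm (c \<alpha> * monom_deriv i \<alpha> (x - p)) \<le> ?M \<alpha>" if "x \<in> S" for x i \<alpha>
  proof -
    have "\<bar>(x - p) $ j\<bar> \<le> \<rho> / 2" for j
      using component_le_norm_cart[of "x - p" j] that by (simp add: S_def dist_norm norm_minus_commute)
    from mult_left_mono[OF monom_deriv_bound[OF \<rho> this, of i \<alpha>] abs_ge_zero[of "c \<alpha>"]]
    show ?thesis by (simp add: abs_mult)
  qed
  have summable: "(\<lambda>\<alpha>. c \<alpha> * monom_deriv i \<alpha> (x - p)) summable_on UNIV" if "x \<in> S" for x i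
    by (rule abs_summable_summable, rule summable_on_comparison_test[OF M]) (use bound that in auto)
  define D where "D = (\<lambda>i x. \<Sum>\<^sub>\<infinity>\<alpha>. c \<alpha> * monom_deriv i \<alpha> (x - p))"
  have "infinite (UNIV :: ('n \<Rightarrow> nat) set)"
  proof
    assume "finite (UNIV :: ('n \<Rightarrow> nat) set)"
    moreover have "inj (\<lambda>(m::nat) (i::'n). m)" by (rule injI) (auto dest: fun_cong)
    ultimately have "finite (UNIV :: nat set)"
      using finite_subset[OF subset_UNIV] finite_imageD by blast
    thus False by simp
  qed
  then obtain e :: "nat \<Rightarrow> 'n \<Rightarrow> nat" where e: "bij_betw e UNIV UNIV"
    using countable_infiniteE'[of "UNIV :: ('n \<Rightarrow> nat) set"] by auto
  have sum_e: "(\<lambda>n. g (e n)) sums s" if "(g has_sum s) UNIV" for g :: "('n \<Rightarrow> nat) \<Rightarrow> real" and s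
    using that has_sum_reindex_bij_betw[OF e, of g s] by (auto intro: has_sum_imp_sums)
  have "summable (\<lambda>n. ?M (e n))"
    using sum_e[OF has_sum_infsum[OF M]] by (rule sums_summable)
  hence "uniform_limit S (\<lambda>n x. \<Sum>m<n. c (e m) * monom_deriv i (e m) (x - p))
      (\<lambda>x. \<Sum>m. c (e m) * monom_deriv i (e m) (x - p)) sequentially" for i
    by (intro Weierstrass_m_test[where M="\<lambda>n. ?M (e n)"]) (use bound in auto)
  moreover have "(\<Sum>m. c (e m) * monom_deriv i (e m) (x - p)) = D i x" if "x \<in> S" for x i
    using sum_e[OF has_sum_infsum[OF summable[OF that]]] by (simp add: D_def sums_iff)
  ultimately have unif: "uniform_limit S (\<lambda>n x. \<Sum>m<n. c (e m) * monom_deriv i (e m) (x - p))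
      (D i) sequentially" for i
    by (simp add: uniform_limit_iff)

  define T where "T = (\<lambda>n x. c (e n) * (\<Prod>i\<in>UNIV. (x $ i - p $ i) ^ e n i))"
  define T' where "T' = (\<lambda>n x h. c (e n) * (\<Sum>i\<in>UNIV. h $ i * monom_deriv i (e n) (x - p)))"
  have F: "(\<lambda>n. T n x) sums F x" if "x \<in> S" for x
    unfolding T_def
  proof (rule sum_e)
    have "x \<in> ball p r" using that \<open>\<rho> \<le> r\<close> \<rho> by (auto simp: S_def)
    thus "((\<lambda>a. c a * (\<Prod>i\<in>UNIV. (x $ i - p $ i) ^ a i)) has_sum F x) UNIV"
      using assms(1) by (simp add: has_power_series_def)
  qed
  have "p \<in> S" using \<rho> by (simp add: S_def)
  have "\<exists>g. \<forall>x\<in>S. (\<lambda>n. T n x) sums (g x) \<and>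
      (g has_derivative (\<lambda>h. \<Sum>i\<in>UNIV. h $ i * D i x)) (at x within S)"
  proof (rule has_derivative_series[where f=T and f'=T' and x=p and l="F p"])
    show "p \<in> S" "(\<lambda>n. T n p) sums F p" by fact (rule F, fact)
    show "(T n has_derivative T' n x) (at x within S)" for n x
      unfolding T_def T'_def by (intro has_derivative_mult_right has_derivative_monom)
    fix \<epsilon> :: real assume "\<epsilon> > 0"
    define \<delta> where "\<delta> = \<epsilon> / CARD('n)"
    have "\<delta> > 0" using \<open>\<epsilon> > 0\<close> by (simp add: \<delta>_def)
    hence "\<forall>\<^sub>F n in sequentially. \<forall>i. \<forall>x\<in>S.
        dist (\<Sum>m<n. c (e m) * monom_deriv i (e m) (x - p)) (D i x) < \<delta>"
      using unif by (auto simp: uniform_limit_iff eventually_all_finite)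
    thus "\<forall>\<^sub>F n in sequentially. \<forall>x\<in>S. \<forall>h.
        norm ((\<Sum>m<n. T' m x h) - (\<Sum>i\<in>UNIV. h $ i * D i x)) \<le> \<epsilon> * norm h"
    proof eventually_elim
      case (elim n)
      show ?case
      proof (intro ballI allI)
        fix x h assume "x \<in> S"
        have "(\<Sum>m<n. T' m x h) = (\<Sum>i\<in>UNIV. h $ i * (\<Sum>m<n. c (e m) * monom_deriv i (e m) (x - p)))"
          unfolding T'_def sum_distrib_left by (subst sum.swap) (simp add: mult_ac)
        hence "norm ((\<Sum>m<n. T' m x h) - (\<Sum>i\<in>UNIV. h $ i * D i x)) =
            norm (\<Sum>i\<in>UNIV. h $ i * ((\<Sum>m<n. c (e m) * monom_deriv i (e m) (x - p)) - D i x))"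
          by (simp add: algebra_simps sum_subtractf)
        also have "\<dots> \<le> (\<Sum>i\<in>(UNIV::'n set). norm h * \<delta>)"
        proof (rule sum_norm_le)
          fix i
          show "norm (h $ i * ((\<Sum>m<n. c (e m) * monom_deriv i (e m) (x - p)) - D i x)) \<le> norm h * \<delta>"
            unfolding norm_mult using elim \<open>x \<in> S\<close> component_le_norm_cart[of h i]
            by (intro mult_mono) (auto simp: dist_norm less_imp_le)
        qed
        also have "\<dots> = \<epsilon> * norm h" by (simp add: \<delta>_def)
        finally show "norm ((\<Sum>m<n. T' m x h) - (\<Sum>i\<in>UNIV. h $ i * D i x)) \<le> \<epsilon> * norm h" .
      qed
    qed
  qed (simp add: S_def)
  then obtain g where g: "\<And>x. x \<in> S \<Longrightarrow> (\<lambda>n. T n x) sums (g x)"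
    "\<And>x. x \<in> S \<Longrightarrow> (g has_derivative (\<lambda>h. \<Sum>i\<in>UNIV. h $ i * D i x)) (at x within S)"
    by blast
  have gF: "g x = F x" if "x \<in> S" for x
    using g(1)[OF that] F[OF that] by (rule sums_unique2)
  have "open S" by (simp add: S_def)
  have dF: "(F has_derivative (\<lambda>h. \<Sum>i\<in>UNIV. h $ i * D i x)) (at x)" if "x \<in> S" for x
    using has_derivative_transform[OF that gF[symmetric] g(2)[OF that]]
      at_within_open[OF that \<open>open S\<close>] by simp
  show ?thesis
  proof (rule that[of "\<rho> / 2"])
    show "(F has_derivative
      (\<lambda>h. \<Sum>i\<in>UNIV. h $ i * (\<Sum>\<^sub>\<infinity>\<alpha>. c \<alpha> * monom_deriv i \<alpha> (x - p)))) (at x)"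
      if "x \<in> ball p (\<rho> / 2)" for x
      using dF that by (simp add: S_def D_def)
  qed (use \<rho> summable in \<open>auto simp: S_def\<close>)
qed

lemma partial_deriv_eqI:
  assumes "(F has_derivative (\<lambda>h. \<Sum>j\<in>UNIV. h $ j * d j)) (at x)"
  shows "partial_deriv i F x = d i"
proof -
  have "((\<lambda>t. x + t *\<^sub>R axis i 1) has_derivative (\<lambda>t. t *\<^sub>R axis i 1)) (at (0::real))"
    by (auto intro!: derivative_eq_intros)
  moreover have "(F has_derivative (\<lambda>h. \<Sum>j\<in>UNIV. h $ j * d j)) (at (x + 0 *\<^sub>R axis i 1))"
    using assms by simp
  ultimately have "((\<lambda>t. F (x + t *\<^sub>R axis i 1)) has_derivative
      (\<lambda>t. \<Sum>j\<in>UNIV. (t *\<^sub>R axis i 1 :: real ^ 'a) $ j * d j)) (at 0)"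
    by (rule has_derivative_compose)
  moreover have "(\<Sum>j\<in>UNIV. (t *\<^sub>R axis i 1 :: real ^ 'a) $ j * d j) = d i * t" for t
    by (subst sum.remove[of UNIV i]) (auto simp: axis_def intro!: sum.neutral)
  ultimately show ?thesis
    unfolding partial_deriv_def by (intro DERIV_imp_deriv) (simp add: has_field_derivative_def)
qed

lemma has_power_series_partial_deriv:
  fixes p :: "real ^ 'n"
  assumes "has_power_series F c p r" "r > 0"
  obtains \<rho> where "\<rho> > 0" "\<And>i. has_power_series (partial_deriv i F) (diff_coeffs i c) p \<rho>"
    "\<And>x. x \<in> ball p \<rho> \<Longrightarrow>
       (F has_derivative (\<lambda>h. \<Sum>i\<in>UNIV. h $ i * partial_deriv i F x)) (at x)"
proof -
  obtain \<rho> where \<rho>: "\<rho> > 0"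
    "\<And>x i. x \<in> ball p \<rho> \<Longrightarrow> (\<lambda>\<alpha>. c \<alpha> * monom_deriv i \<alpha> (x - p)) summable_on UNIV"
    "\<And>x. x \<in> ball p \<rho> \<Longrightarrow> (F has_derivative
      (\<lambda>h. \<Sum>i\<in>UNIV. h $ i * (\<Sum>\<^sub>\<infinity>\<alpha>. c \<alpha> * monom_deriv i \<alpha> (x - p)))) (at x)"
    by (rule has_power_series_termwise_deriv[OF assms]) blast
  have eq: "partial_deriv i F x = (\<Sum>\<^sub>\<infinity>\<alpha>. c \<alpha> * monom_deriv i \<alpha> (x - p))" if "x \<in> ball p \<rho>" for x i
    by (rule partial_deriv_eqI[OF \<rho>(3)[OF that]])
  show ?thesis
  proof (rule that[OF \<rho>(1)])
    show "has_power_series (partial_deriv i F) (diff_coeffs i c) p \<rho>" for i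
      unfolding has_power_series_def
      by (intro ballI has_sum_diff_coeffs, subst eq) (use \<rho>(2) in auto)
  qed (use \<rho>(3) in \<open>simp add: eq\<close>)
qed

lemma real_analytic_partial_deriv:
  assumes "real_analytic_on F U"
  shows "real_analytic_on (partial_deriv i F) U"
  unfolding real_analytic_on_iff
proof
  fix p assume "p \<in> U"
  then obtain c r where cr: "has_power_series F c p r" "r > 0"
    using assms by (auto simp: real_analytic_on_iff)
  obtain \<rho> where "\<rho> > 0" "has_power_series (partial_deriv i F) (diff_coeffs i c) p \<rho>"
    by (rule has_power_series_partial_deriv[OF cr]) blast
  thus "\<exists>c. \<exists>r>0. has_power_series (partial_deriv i F) c p r"
    by blast
qed

lemma real_analytic_has_derivative:
  assumes "real_analytic_on F U" "x \<in> U"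
  shows "(F has_derivative (\<lambda>h. \<Sum>i\<in>UNIV. h $ i * partial_deriv i F x)) (at x)"
proof -
  obtain c r where cr: "has_power_series F c x r" "r > 0"
    using assms by (auto simp: real_analytic_on_iff)
  show ?thesis
    by (rule has_power_series_partial_deriv[OF cr]) (use centre_in_ball in blast)
qed

lemma diff_coeffs_commute: "diff_coeffs i (diff_coeffs j c) = diff_coeffs j (diff_coeffs i c)"
  by (cases "i = j") (auto simp: fun_eq_iff diff_coeffs_def fun_upd_twist)

text \<open>
  Both mixed derivatives have power series with the same coefficients, because shifting and
  weighting the coefficients in two directions commutes.
\<close>

lemma real_analytic_partial_deriv_commute:
  assumes "real_analytic_on F U" "x \<in> U"
  shows "partial_deriv i (partial_deriv j F) x = partial_deriv j (partial_deriv i F) x"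
proof -
  obtain c r where cr: "has_power_series F c x r" "r > 0"
    using assms by (auto simp: real_analytic_on_iff)
  obtain \<rho> where \<rho>: "\<rho> > 0" "\<And>i. has_power_series (partial_deriv i F) (diff_coeffs i c) x \<rho>"
    by (rule has_power_series_partial_deriv[OF cr]) blast
  have "((\<lambda>\<alpha>. diff_coeffs i (diff_coeffs j c) \<alpha> * (\<Prod>k\<in>UNIV. (x $ k - x $ k) ^ \<alpha> k))
      has_sum partial_deriv i (partial_deriv j F) x) UNIV" for i j
  proof -
    obtain \<sigma> where "\<sigma> > 0"
      "has_power_series (partial_deriv i (partial_deriv j F)) (diff_coeffs i (diff_coeffs j c)) x \<sigma>"
      by (rule has_power_series_partial_deriv[OF \<rho>(2) \<rho>(1)]) blast
    thus ?thesis using centre_in_ball unfolding has_power_series_def by blast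
  qed
  from has_sum_unique[OF this[of i j] this[of j i, unfolded diff_coeffs_commute[of j i]]]
  show ?thesis .
qed

section \<open>Regularity along lines and on compact sets\<close>

lemma real_analytic_continuous_on:
  assumes "real_analytic_on F UNIV"
  shows "continuous_on S F"
  using real_analytic_has_derivative[OF assms] has_derivative_continuous
  by (blast intro: continuous_at_imp_continuous_on)

lemma real_analytic_deriv_along_line:
  fixes p v :: "real ^ 'n"
  assumes "real_analytic_on F UNIV"
  shows "((\<lambda>t. F (p + t *\<^sub>R v)) has_real_derivative
     (\<Sum>i\<in>UNIV. v $ i * partial_deriv i F (p + t *\<^sub>R v))) (at t)"
proof -
  have "((\<lambda>t. p + t *\<^sub>R v) has_derivative (\<lambda>t. t *\<^sub>R v)) (at t)"
    by (auto intro!: derivative_eq_intros)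
  from has_derivative_compose[OF this real_analytic_has_derivative[OF assms UNIV_I]]
  have "((\<lambda>t. F (p + t *\<^sub>R v)) has_derivative
     (\<lambda>s. \<Sum>i\<in>UNIV. (s *\<^sub>R v) $ i * partial_deriv i F (p + t *\<^sub>R v))) (at t)" .
  thus ?thesis
    unfolding has_field_derivative_def
    by (rule has_derivative_eq_rhs) (simp add: fun_eq_iff sum_distrib_left mult_ac)
qed

lemma real_analytic_deriv_along_axis:
  fixes p :: "real ^ 'n"
  assumes "real_analytic_on F UNIV"
  shows "((\<lambda>t. F (p + t *\<^sub>R axis j 1)) has_real_derivative
     partial_deriv j F (p + t *\<^sub>R axis j 1)) (at t)"
proof -
  have "(\<Sum>i\<in>UNIV. (axis j 1 :: real ^ 'n) $ i * d i) = d j" for d :: "'n \<Rightarrow> real"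
    by (subst sum.remove[of UNIV j]) (auto simp: axis_def intro!: sum.neutral)
  thus ?thesis
    using real_analytic_deriv_along_line[OF assms, of p "axis j 1" t] by simp
qed

lemma finite_family_bounded_on_compact:
  fixes G :: "'b::finite \<Rightarrow> 'a::topological_space \<Rightarrow> real"
  assumes "compact K" "\<And>j. continuous_on K (G j)"
  obtains M where "M > 0" "\<And>j x. x \<in> K \<Longrightarrow> \<bar>G j x\<bar> \<le> M"
proof -
  have "\<exists>b>0. \<forall>x\<in>K. \<bar>G j x\<bar> \<le> b" for j
    using compact_imp_bounded[OF compact_continuous_image[OF assms(2)[of j] assms(1)]]
    by (auto simp: bounded_pos)
  then obtain b where b: "\<And>j. b j > 0" "\<And>j x. x \<in> K \<Longrightarrow> \<bar>G j x\<bar> \<le> b j"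
    by metis
  show ?thesis
  proof (rule that[of "\<Sum>j\<in>UNIV. b j"])
    show "\<bar>G j x\<bar> \<le> (\<Sum>j\<in>UNIV. b j)" if "x \<in> K" for j x
      using b(2)[OF that] b(1) member_le_sum[of j UNIV b] by (smt (verit) UNIV_I finite)
  qed (use b(1) in \<open>auto intro: sum_pos\<close>)
qed

section \<open>Two one-dimensional estimates\<close>

text \<open>
  If the derivative at 0 were large compared with the value, the second-order Taylor bound would
  force the function below zero at \<open>- \<phi>' 0 / M\<close>, the minimum of the majorising parabola.
\<close>

lemma nonneg_imp_deriv_square_bound:
  fixes \<phi> \<phi>' \<phi>'' :: "real \<Rightarrow> real"
  assumes "\<And>s. (\<phi> has_real_derivative \<phi>' s) (at s)" "\<And>s. (\<phi>' has_real_derivative \<phi>'' s) (at s)"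
    and nonneg: "\<And>s. \<phi> s \<ge> 0"
    and M: "M > 0" "\<bar>\<phi>' 0\<bar> \<le> M" "\<And>s. \<bar>s\<bar> \<le> 1 \<Longrightarrow> \<phi>'' s \<le> M"
  shows "(\<phi>' 0)\<^sup>2 \<le> 2 * M * \<phi> 0"
proof -
  define s where "s = - \<phi>' 0 / M"
  define d where "d = (\<lambda>m::nat. if m = 0 then \<phi> else if m = 1 then \<phi>' else \<phi>'')"
  have s: "\<bar>s\<bar> \<le> 1" using M(1,2) by (simp add: s_def)
  have "\<exists>t. \<bar>t\<bar> \<le> \<bar>s\<bar> \<and> \<phi> s = (\<Sum>m<2. d m 0 / fact m * s ^ m) + d 2 t / fact 2 * s ^ 2"
    by (rule Maclaurin_bi_le) (use assms in \<open>auto simp: d_def less_2_cases_iff\<close>)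
  then obtain t where t: "\<bar>t\<bar> \<le> \<bar>s\<bar>" "\<phi> s = \<phi> 0 + \<phi>' 0 * s + \<phi>'' t / 2 * s\<^sup>2"
    by (auto simp: d_def numeral_2_eq_2)
  have "\<phi>'' t / 2 * s\<^sup>2 \<le> M / 2 * s\<^sup>2"
    by (intro mult_right_mono divide_right_mono M(3)) (use t s in auto)
  hence "0 \<le> \<phi> 0 + \<phi>' 0 * s + M / 2 * s\<^sup>2"
    using nonneg[of s] t(2) by linarith
  also have "\<dots> = \<phi> 0 - (\<phi>' 0)\<^sup>2 / (2 * M)"
    using M(1) by (simp add: s_def field_simps power2_eq_square)
  finally show ?thesis
    using M(1) by (simp add: field_simps)
qed

text \<open>
  The integrating factor \<open>exp (- C * s)\<close> turns the differential inequality into monotonicity.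
\<close>

lemma gronwall_zero_right:
  fixes u u' :: "real \<Rightarrow> real"
  assumes u': "\<And>s. 0 \<le> s \<Longrightarrow> s \<le> t \<Longrightarrow> (u has_real_derivative u' s) (at s)"
    and le: "\<And>s. 0 \<le> s \<Longrightarrow> s \<le> t \<Longrightarrow> u' s \<le> C * u s"
    and "u 0 = 0" "t \<ge> 0"
  shows "u t \<le> 0"
proof -
  have "u t * exp (- C * t) \<le> u 0 * exp (- C * 0)"
  proof (rule DERIV_nonpos_imp_nonincreasing[OF \<open>t \<ge> 0\<close>])
    fix s assume s: "0 \<le> s" "s \<le> t"
    have "((\<lambda>s. u s * exp (- C * s)) has_real_derivative (u' s - C * u s) * exp (- C * s)) (at s)"
      using u'[OF s] by (auto intro!: derivative_eq_intros simp: algebra_simps)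
    moreover have "(u' s - C * u s) * exp (- C * s) \<le> 0"
      using le[OF s] by (intro mult_nonpos_nonneg) auto
    ultimately show "\<exists>y. ((\<lambda>s. u s * exp (- C * s)) has_real_derivative y) (at s) \<and> y \<le> 0"
      by blast
  qed
  thus ?thesis
    using \<open>u 0 = 0\<close> by (simp add: mult_le_0_iff)
qed

lemma gronwall_zero:
  fixes u u' :: "real \<Rightarrow> real"
  assumes u': "\<And>s. (u has_real_derivative u' s) (at s)"
    and le: "\<And>s. \<bar>s\<bar> \<le> \<bar>t\<bar> \<Longrightarrow> \<bar>u' s\<bar> \<le> C * u s"
    and nonneg: "\<And>s. u s \<ge> 0" and "u 0 = 0"
  shows "u t = 0"
proof (cases "t \<ge> 0")
  case True
  hence "u t \<le> 0"
    by (intro gronwall_zero_right[where u=u and u'=u' and C=C]) (use assms in \<open>auto simp: abs_le_iff\<close>)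
  thus ?thesis using nonneg[of t] by simp
next
  case False
  have "((\<lambda>s. u (- s)) has_real_derivative - u' (- s)) (at s)" for s
    using DERIV_mirror[THEN iffD1, OF u'[of "-s"]] by simp
  hence "u (- (- t)) \<le> 0"
    by (intro gronwall_zero_right[where u="\<lambda>s. u (- s)" and u'="\<lambda>s. - u' (- s)" and C=C and t="-t"])
       (use False assms(4) le in \<open>auto simp: abs_le_iff\<close>)
  thus ?thesis using nonneg[of t] by simp
qed

section \<open>The Hessian along a light-like direction\<close>

text \<open>
  The pointwise inequality behind the differential inequality. Here \<open>D\<close> stands for the gradient of
  \<open>f\<close>, \<open>S\<close> for its Hessian and \<open>G\<close> for the gradient of \<open>B\<close> at one point. The expansion of the quadratic form
  at \<open>v = D - g\<close> produces only terms controlled by \<open>B\<close>, by \<open>|g|\<^sup>2\<close>, or by \<open>|g| |G|\<close>, and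
  \<open>2 u = B + |g|\<^sup>2\<close>.
\<close>

lemma quadratic_form_bound:
  fixes D v G :: "'n::finite \<Rightarrow> real" and S :: "'n \<Rightarrow> 'n \<Rightarrow> real" and B u K M C :: real
  defines "B \<equiv> 1 - (\<Sum>i\<in>UNIV. (D i)\<^sup>2)" and "u \<equiv> 1 - (\<Sum>i\<in>UNIV. v i * D i)"
  assumes sym: "\<And>i j. S i j = S j i" and M: "\<And>i j. \<bar>S i j\<bar> \<le> M"
    and v: "(\<Sum>i\<in>UNIV. (v i)\<^sup>2) = 1"
    and "B \<ge> 0" "K \<ge> 0" "C \<ge> 0"
    and A: "\<bar>B * (\<Sum>i\<in>UNIV. S i i) + (\<Sum>i\<in>UNIV. \<Sum>j\<in>UNIV. D i * D j * S i j)\<bar> \<le> K * B"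
    and G: "\<And>j. G j = - 2 * (\<Sum>i\<in>UNIV. D i * S i j)" "\<And>j. (G j)\<^sup>2 \<le> C * B"
  shows "\<bar>\<Sum>i\<in>UNIV. \<Sum>j\<in>UNIV. v i * v j * S i j\<bar>
    \<le> (K + CARD('n) * M + CARD('n) * C + (1 + CARD('n) * M)) * (2 * u)" (is "\<bar>?Q\<bar> \<le> _")
proof -
  define g where "g = (\<lambda>i. D i - v i)"
  define g2 where "g2 = (\<Sum>i\<in>UNIV. (g i)\<^sup>2)"
  define AA where "AA = B * (\<Sum>i\<in>UNIV. S i i) + (\<Sum>i\<in>UNIV. \<Sum>j\<in>UNIV. D i * D j * S i j)"
  have "M \<ge> 0" using M[of undefined undefined] by linarith
  have g2: "g2 \<ge> 0" by (simp add: g2_def sum_nonneg)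
  have u: "2 * u = B + g2"
    using v by (simp add: u_def B_def g2_def g_def power2_diff sum.distrib sum_subtractf
        sum_distrib_left mult_ac)
  have tr: "\<bar>\<Sum>i\<in>UNIV. S i i\<bar> \<le> CARD('n) * M"
    by (rule sum_abs[THEN order_trans])
       (use sum_bounded_above[of UNIV "\<lambda>i. \<bar>S i i\<bar>" M, OF M] in simp)
  have gG: "\<bar>\<Sum>j\<in>UNIV. g j * G j\<bar> \<le> g2 + CARD('n) * C * B"
  proof -
    have "\<bar>\<Sum>j\<in>UNIV. g j * G j\<bar> \<le> (\<Sum>j\<in>UNIV. (g j)\<^sup>2 + C * B)"
    proof (rule sum_abs[THEN order_trans], rule sum_mono)
      fix j
      have "2 * (\<bar>g j\<bar> * \<bar>G j\<bar>) \<le> (g j)\<^sup>2 + (G j)\<^sup>2"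
        using sum_squares_bound[of "\<bar>g j\<bar>" "\<bar>G j\<bar>"] by simp
      moreover have "(G j)\<^sup>2 \<le> C * B" "(G j)\<^sup>2 \<ge> 0" "(g j)\<^sup>2 \<ge> 0" using G(2) by auto
      ultimately show "\<bar>g j * G j\<bar> \<le> (g j)\<^sup>2 + C * B"
        unfolding abs_mult by linarith
    qed
    thus ?thesis by (simp add: sum.distrib g2_def)
  qed
  have gSg: "\<bar>\<Sum>i\<in>UNIV. \<Sum>j\<in>UNIV. g i * g j * S i j\<bar> \<le> CARD('n) * M * g2"
  proof -
    have "\<bar>g i * g j * S i j\<bar> \<le> M * ((g i)\<^sup>2 / 2 + (g j)\<^sup>2 / 2)" for i j
    proof -
      have "\<bar>g i\<bar> * \<bar>g j\<bar> \<le> (g i)\<^sup>2 / 2 + (g j)\<^sup>2 / 2"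
        using sum_squares_bound[of "\<bar>g i\<bar>" "\<bar>g j\<bar>"] by simp
      hence "\<bar>S i j\<bar> * (\<bar>g i\<bar> * \<bar>g j\<bar>) \<le> M * ((g i)\<^sup>2 / 2 + (g j)\<^sup>2 / 2)"
        using M \<open>M \<ge> 0\<close> by (intro mult_mono) auto
      thus ?thesis by (simp add: abs_mult mult_ac)
    qed
    hence "\<bar>\<Sum>i\<in>UNIV. \<Sum>j\<in>UNIV. g i * g j * S i j\<bar>
        \<le> (\<Sum>i\<in>UNIV. \<Sum>j\<in>(UNIV::'n set). M * ((g i)\<^sup>2 / 2 + (g j)\<^sup>2 / 2))"
      by (intro sum_abs[THEN order_trans] sum_mono)
    also have "\<dots> = CARD('n) * M * g2"
      by (simp add: sum.distrib flip: sum_distrib_left sum_divide_distrib) (simp add: g2_def algebra_simps)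
    finally show ?thesis .
  qed
  have "?Q = (\<Sum>i\<in>UNIV. \<Sum>j\<in>UNIV. D i * D j * S i j) - (\<Sum>i\<in>UNIV. \<Sum>j\<in>UNIV. g i * D j * S i j)
      - (\<Sum>i\<in>UNIV. \<Sum>j\<in>UNIV. D i * g j * S i j) + (\<Sum>i\<in>UNIV. \<Sum>j\<in>UNIV. g i * g j * S i j)"
    unfolding sum_subtractf[symmetric] sum.distrib[symmetric]
    by (intro sum.cong) (auto simp: g_def algebra_simps)
  moreover have "(\<Sum>i\<in>UNIV. \<Sum>j\<in>UNIV. D i * g j * S i j) = - (\<Sum>j\<in>UNIV. g j * G j) / 2"
    by (subst sum.swap) (simp add: G(1) sum_distrib_left sum_divide_distrib sum_negf mult_ac)
  moreover have "(\<Sum>i\<in>UNIV. \<Sum>j\<in>UNIV. g i * D j * S i j) = - (\<Sum>j\<in>UNIV. g j * G j) / 2"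
    by (simp add: G(1) sum_distrib_left sum_divide_distrib sum_negf mult_ac sym)
  ultimately have Q: "?Q = AA - B * (\<Sum>i\<in>UNIV. S i i) + (\<Sum>j\<in>UNIV. g j * G j)
      + (\<Sum>i\<in>UNIV. \<Sum>j\<in>UNIV. g i * g j * S i j)"
    by (simp add: AA_def)
  have "\<bar>B * (\<Sum>i\<in>UNIV. S i i)\<bar> \<le> CARD('n) * M * B"
    using mult_left_mono[OF tr \<open>B \<ge> 0\<close>] \<open>B \<ge> 0\<close> by (simp add: abs_mult mult_ac)
  hence "\<bar>?Q\<bar> \<le> K * B + CARD('n) * M * B + (g2 + CARD('n) * C * B) + CARD('n) * M * g2"
    using Q A gG gSg unfolding AA_def[symmetric] by linarith
  also have "\<dots> = (K + CARD('n) * M + CARD('n) * C) * B + (1 + CARD('n) * M) * g2"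
    by (simp add: algebra_simps)
  also have "\<dots> \<le> (K + CARD('n) * M + CARD('n) * C + (1 + CARD('n) * M)) * (B + g2)"
    unfolding distrib_left[of _ B g2]
    using \<open>B \<ge> 0\<close> g2 \<open>M \<ge> 0\<close> \<open>K \<ge> 0\<close> \<open>C \<ge> 0\<close>
    by (intro add_mono[OF mult_right_mono mult_right_mono]) simp_all
  finally show "\<bar>?Q\<bar> \<le> (K + CARD('n) * M + CARD('n) * C + (1 + CARD('n) * M)) * (2 * u)"
    unfolding u .
qed

text \<open>
  The term being squared is the \<open>j\<close>-th partial derivative of \<open>B\<close>. As \<open>B\<close> is nonnegative everywhere,
  the one-dimensional estimate applies to it along each coordinate axis. The segments used reach a
  distance 1 beyond the ball, hence the second derivative is bounded on the ball of radius \<open>T + 1\<close>.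
\<close>

lemma gradient_B_bound:
  fixes f :: "real ^ 'n \<Rightarrow> real"
  assumes f: "real_analytic_on f UNIV" and B: "\<And>x. B_fun f x \<ge> 0"
  obtains C where "C \<ge> 0"
    "\<And>x j. x \<in> cball p T \<Longrightarrow>
      (- 2 * (\<Sum>i\<in>UNIV. partial_deriv i f x * partial_deriv j (partial_deriv i f) x))\<^sup>2 \<le> C * B_fun f x"
proof -
  define G where "G = (\<lambda>j x. - 2 * (\<Sum>i\<in>UNIV. partial_deriv i f x * partial_deriv j (partial_deriv i f) x))"
  define H where "H = (\<lambda>j x. - 2 * (\<Sum>i\<in>UNIV. (partial_deriv j (partial_deriv i f) x)\<^sup>2 +
      partial_deriv i f x * partial_deriv j (partial_deriv j (partial_deriv i f)) x))"
  note analytic = f real_analytic_partial_deriv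
  have contG: "continuous_on K (G j)" for j K
    unfolding G_def by (intro continuous_intros real_analytic_continuous_on analytic)
  have contH: "continuous_on K (H j)" for j K
    unfolding H_def by (intro continuous_intros real_analytic_continuous_on analytic)
  obtain M1 where M1: "M1 > 0" "\<And>j x. x \<in> cball p T \<Longrightarrow> \<bar>G j x\<bar> \<le> M1"
    by (rule finite_family_bounded_on_compact[of "cball p T" G, OF compact_cball contG]) blast
  obtain M2 where M2: "M2 > 0" "\<And>j x. x \<in> cball p (T + 1) \<Longrightarrow> \<bar>H j x\<bar> \<le> M2"
    by (rule finite_family_bounded_on_compact[of "cball p (T + 1)" H, OF compact_cball contH]) blast
  define M where "M = M1 + M2"
  show ?thesis
  proof (rule that[of "2 * M"], goal_cases)
    case (2 x j)
    define l where "l = (\<lambda>s. x + s *\<^sub>R axis j 1)"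
    have l0: "l 0 = x" by (simp add: l_def)
    have d: "((\<lambda>s. F (l s)) has_real_derivative partial_deriv j F (l s)) (at s)"
      if "real_analytic_on F UNIV" for F s
      unfolding l_def by (rule real_analytic_deriv_along_axis[OF that])
    have "(G j (l 0))\<^sup>2 \<le> 2 * M * B_fun f (l 0)"
    proof (rule nonneg_imp_deriv_square_bound)
      show "((\<lambda>s. B_fun f (l s)) has_real_derivative G j (l s)) (at s)" for s
        unfolding B_fun_def G_def
        by (auto intro!: derivative_eq_intros d analytic
            simp: sum_distrib_left sum_negf[symmetric] mult_ac)
      show "((\<lambda>s. G j (l s)) has_real_derivative H j (l s)) (at s)" for s
        unfolding G_def H_def
        by (auto intro!: derivative_eq_intros d analytic
            simp: sum_distrib_left power2_eq_square algebra_simps intro!: sum.cong)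
      show "\<bar>G j (l 0)\<bar> \<le> M"
        using M1(2)[OF 2, of j] M2(1) by (simp add: l0 M_def)
      show "H j (l s) \<le> M" if "\<bar>s\<bar> \<le> 1" for s
      proof -
        have "dist p (l s) \<le> dist p x + dist x (l s)" by (rule dist_triangle)
        also have "dist x (l s) \<le> 1" using that by (simp add: l_def dist_norm norm_axis_1)
        finally have "l s \<in> cball p (T + 1)" using 2 by simp
        thus ?thesis using M2(2)[of "l s" j] M1(1) by (simp add: M_def)
      qed
    qed (use B M1 M2 in \<open>auto simp: M_def\<close>)
    thus ?case by (simp add: l0 G_def)
  qed (use M1 M2 in \<open>auto simp: M_def\<close>)
qed

lemma abs_A_le:
  assumes "(A::real)\<^sup>2 = k * B ^ 3" "0 \<le> B" "B \<le> 1"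
  shows "\<bar>A\<bar> \<le> sqrt \<bar>k\<bar> * B"
proof (rule power2_le_imp_le)
  have "k * B ^ 3 \<le> \<bar>k\<bar> * B\<^sup>2"
    using assms by (intro mult_mono power_decreasing) auto
  thus "\<bar>A\<bar>\<^sup>2 \<le> (sqrt \<bar>k\<bar> * B)\<^sup>2"
    using assms by (simp add: power_mult_distrib)
qed (use assms in auto)

text \<open>
  The line theorem: a light-like point of a graph without time-like points propagates along the
  whole light-like line in the direction of the gradient. The defect \<open>u\<close> is chosen linear in the
  gradient, so that its derivative is a single value of the Hessian; the differential inequality
  then comes from \<open>quadratic_form_bound\<close>, with constants uniform on the ball of radius \<open>\<bar>t\<bar>\<close>.
\<close>

lemma deriv_along_light_like_line:
  fixes f :: "real ^ 'n \<Rightarrow> real"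
  assumes f: "real_analytic_on f UNIV" and B: "\<And>x. B_fun f x \<ge> 0"
    and k: "\<And>x. (A_fun f x)\<^sup>2 = k * B_fun f x ^ 3"
    and "B_fun f p = 0"
  defines "v \<equiv> \<chi> i. partial_deriv i f p"
  shows "(\<Sum>i\<in>UNIV. v $ i * partial_deriv i f (p + t *\<^sub>R v)) = 1"
proof -
  define S where "S = (\<lambda>x i j. partial_deriv i (partial_deriv j f) x)"
  define D where "D = (\<lambda>x i. partial_deriv i f x)"
  note analytic = f real_analytic_partial_deriv
  have sym: "S x i j = S x j i" for x i j
    unfolding S_def by (rule real_analytic_partial_deriv_commute[OF f UNIV_I])
  have v: "(\<Sum>i\<in>UNIV. (v $ i)\<^sup>2) = 1"
    using \<open>B_fun f p = 0\<close> by (simp add: B_fun_def v_def)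
  have norm_v: "norm v = 1"
    using v by (simp add: norm_vec_def L2_set_def)
  define u where "u = (\<lambda>t. 1 - (\<Sum>i\<in>UNIV. v $ i * D (p + t *\<^sub>R v) i))"
  define u' where "u' = (\<lambda>t. - (\<Sum>i\<in>UNIV. \<Sum>j\<in>UNIV. v $ i * v $ j * S (p + t *\<^sub>R v) i j))"
  obtain C where C: "C \<ge> 0"
    "\<And>x j. x \<in> cball p \<bar>t\<bar> \<Longrightarrow> (- 2 * (\<Sum>i\<in>UNIV. D x i * S x j i))\<^sup>2 \<le> C * B_fun f x"
    unfolding D_def S_def by (rule gradient_B_bound[OF f B]) blast
  have contS: "continuous_on K (\<lambda>x. S x (fst ij) (snd ij))" for ij K
    unfolding S_def by (intro real_analytic_continuous_on analytic)
  obtain M where M: "\<And>x ij. x \<in> cball p \<bar>t\<bar> \<Longrightarrow> \<bar>S x (fst ij) (snd ij)\<bar> \<le> M"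
    by (rule finite_family_bounded_on_compact[of "cball p \<bar>t\<bar>" "\<lambda>ij x. S x (fst ij) (snd ij)",
          OF compact_cball contS]) blast
  have A: "A_fun f x = B_fun f x * (\<Sum>i\<in>UNIV. S x i i) + (\<Sum>i\<in>UNIV. \<Sum>j\<in>UNIV. D x i * D x j * S x i j)" for x
  proof -
    have "A_fun f x = (\<Sum>i\<in>UNIV. \<Sum>j\<in>UNIV.
        (if j = i then B_fun f x * S x i i else 0) + D x i * D x j * S x i j)"
      unfolding A_fun_def S_def D_def by (intro sum.cong) (auto simp: distrib_right)
    thus ?thesis by (simp add: sum.distrib sum_distrib_left)
  qed
  have B': "B_fun f x = 1 - (\<Sum>i\<in>UNIV. (D x i)\<^sup>2)" for x
    by (simp add: B_fun_def D_def)
  have B1: "B_fun f x \<le> 1" for x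
    by (simp add: B_fun_def sum_nonneg)
  let ?L = "(sqrt \<bar>k\<bar> + CARD('n) * M + CARD('n) * C + (1 + CARD('n) * M)) * 2"
  have le: "\<bar>u' s\<bar> \<le> ?L * u s" if "\<bar>s\<bar> \<le> \<bar>t\<bar>" for s
  proof -
    have "p + s *\<^sub>R v \<in> cball p \<bar>t\<bar>" using that norm_v by (simp add: dist_norm)
    note C' = C(2)[OF this] and M' = M[OF this, of "(i, j)" for i j]
    have "\<bar>u' s\<bar> \<le> (sqrt \<bar>k\<bar> + CARD('n) * M + CARD('n) * C + (1 + CARD('n) * M)) * (2 * u s)"
      unfolding u'_def u_def abs_minus_cancel
    proof (rule quadratic_form_bound[OF sym _ v])
      let ?x = "p + s *\<^sub>R v"
      show "\<bar>S ?x i j\<bar> \<le> M" for i j using M' by simp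
      show "(- 2 * (\<Sum>i\<in>UNIV. D ?x i * S ?x i j))\<^sup>2 \<le> C * (1 - (\<Sum>i\<in>UNIV. (D ?x i)\<^sup>2))" for j
        using C'[of j] by (simp add: B' sym[of _ j])
      show "\<bar>(1 - (\<Sum>i\<in>UNIV. (D ?x i)\<^sup>2)) * (\<Sum>i\<in>UNIV. S ?x i i) +
          (\<Sum>i\<in>UNIV. \<Sum>j\<in>UNIV. D ?x i * D ?x j * S ?x i j)\<bar>
          \<le> sqrt \<bar>k\<bar> * (1 - (\<Sum>i\<in>UNIV. (D ?x i)\<^sup>2))"
        using abs_A_le[OF k[of ?x] B B1] unfolding A B' .
    qed (use B B' C(1) in auto)
    thus ?thesis by (simp add: mult_ac)
  qed
  have du: "(u has_real_derivative u' s) (at s)" for s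
    unfolding u_def u'_def D_def S_def
    by (auto intro!: derivative_eq_intros real_analytic_deriv_along_line analytic sum.cong
        simp: sum_distrib_left sum_negf[symmetric] sym[unfolded S_def] mult_ac)
  have nonneg: "u s \<ge> 0" for s
  proof -
    let ?x = "p + s *\<^sub>R v"
    have "(\<Sum>i\<in>UNIV. v $ i * D ?x i) \<le> (\<Sum>i\<in>UNIV. (v $ i)\<^sup>2 / 2 + (D ?x i)\<^sup>2 / 2)"
    proof (rule sum_mono)
      show "v $ i * D ?x i \<le> (v $ i)\<^sup>2 / 2 + (D ?x i)\<^sup>2 / 2" for i
        using sum_squares_bound[of "v $ i" "D ?x i"] by simp
    qed
    also have "\<dots> = 1 / 2 + (1 - B_fun f ?x) / 2"
      using v by (simp add: sum.distrib B' flip: sum_divide_distrib)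
    also have "\<dots> \<le> 1" using B[of ?x] by (simp add: field_simps)
    finally show ?thesis by (simp add: u_def)
  qed
  have "u 0 = 0"
    using v by (simp add: u_def D_def v_def power2_eq_square)
  with du le nonneg have "u t = 0"
    by (rule gronwall_zero)
  thus ?thesis by (simp add: u_def D_def)
qed

section \<open>Lipschitz functions with a line of extreme slope\<close>

text \<open>
  As \<open>t\<close> tends to infinity, \<open>norm (y + t *\<^sub>R v) - t\<close> tends to \<open>y \<bullet> v\<close>. Squaring the hypothesis gives
  the conclusion without any limit: the terms in \<open>t\<^sup>2\<close> cancel and a large \<open>t\<close> contradicts \<open>a > y \<bullet> v\<close>.
\<close>

lemma asymptotic_norm_bound:
  fixes y v :: "'a::real_inner"
  assumes "norm v = 1" and le: "\<And>t. a + t \<le> norm (y + t *\<^sub>R v)"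
  shows "a \<le> y \<bullet> v"
proof (rule ccontr)
  assume "\<not> a \<le> y \<bullet> v"
  hence pos: "a - y \<bullet> v > 0" by simp
  define t where "t = \<bar>a\<bar> + ((norm y)\<^sup>2 + 1) / (a - y \<bullet> v)"
  have "t \<ge> \<bar>a\<bar>" using pos by (simp add: t_def)
  hence "(a + t)\<^sup>2 \<le> (norm (y + t *\<^sub>R v))\<^sup>2"
    by (intro power_mono le) auto
  also have "\<dots> = (norm y)\<^sup>2 + 2 * t * (y \<bullet> v) + t\<^sup>2"
    using \<open>norm v = 1\<close> unfolding power2_norm_eq_inner norm_eq_1
    by (simp add: inner_add inner_commute power2_eq_square)
  finally have "2 * t * (a - y \<bullet> v) \<le> (norm y)\<^sup>2 - a\<^sup>2"
    by (simp add: power2_eq_square algebra_simps)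
  also have "\<dots> \<le> (norm y)\<^sup>2" by simp
  also have "\<dots> < \<bar>a\<bar> * (a - y \<bullet> v) + ((norm y)\<^sup>2 + 1)"
    using pos by (smt (verit) abs_ge_zero mult_nonneg_nonneg)
  also have "\<dots> = t * (a - y \<bullet> v)" using pos by (simp add: t_def field_simps)
  also have "\<dots> \<le> 2 * t * (a - y \<bullet> v)" using pos \<open>t \<ge> \<bar>a\<bar>\<close> by (intro mult_right_mono) auto
  finally show False by simp
qed

lemma lipschitz_with_unit_slope_line_affine:
  fixes f :: "'a::real_inner \<Rightarrow> real"
  assumes lip: "\<And>x y. \<bar>f x - f y\<bar> \<le> norm (x - y)"
    and "norm v = 1" and line: "\<And>t. f (p + t *\<^sub>R v) = f p + t"
  shows "f x = f p + (x - p) \<bullet> v"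
proof -
  have "f x - f p \<le> (x - p) \<bullet> v"
  proof (rule asymptotic_norm_bound[OF \<open>norm v = 1\<close>])
    show "f x - f p + t \<le> norm (x - p + t *\<^sub>R v)" for t
      using lip[of x "p + (- t) *\<^sub>R v"] unfolding line by (simp add: algebra_simps)
  qed
  moreover have "f p - f x \<le> (p - x) \<bullet> v"
  proof (rule asymptotic_norm_bound[OF \<open>norm v = 1\<close>])
    show "f p - f x + t \<le> norm (p - x + t *\<^sub>R v)" for t
      using lip[of "p + t *\<^sub>R v" x] unfolding line by (simp add: algebra_simps)
  qed
  ultimately show ?thesis by (simp add: inner_diff_left)
qed

lemma real_analytic_lipschitz:
  fixes f :: "real ^ 'n \<Rightarrow> real"
  assumes f: "real_analytic_on f UNIV" and B: "\<And>x. B_fun f x \<ge> 0"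
  shows "\<bar>f x - f y\<bar> \<le> norm (x - y)"
proof -
  have "norm (f x - f y) \<le> 1 * norm (x - y)"
  proof (rule differentiable_bound[OF convex_UNIV])
    show "(f has_derivative (\<lambda>h. \<Sum>i\<in>UNIV. h $ i * partial_deriv i f z)) (at z)" for z
      by (rule real_analytic_has_derivative[OF f UNIV_I])
    show "onorm (\<lambda>h. \<Sum>i\<in>UNIV. h $ i * partial_deriv i f z) \<le> 1" for z
    proof (rule onorm_le)
      fix h :: "real ^ 'n"
      define g :: "real ^ 'n" where "g = (\<chi> i. partial_deriv i f z)"
      have "norm g \<le> 1"
        using B[of z] by (simp add: g_def norm_vec_def L2_set_def B_fun_def)
      hence "\<bar>h \<bullet> g\<bar> \<le> norm h"
        using Cauchy_Schwarz_ineq2[of h g] mult_left_mono[of "norm g" 1 "norm h"] by simp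
      thus "norm (\<Sum>i\<in>UNIV. h $ i * partial_deriv i f z) \<le> 1 * norm h"
        by (simp add: g_def inner_vec_def)
    qed
  qed auto
  thus ?thesis by simp
qed

section \<open>Light-like hyperplanes\<close>

text \<open>
  In the Euclidean inner product the graph is a hyperplane with normal \<open>(v, -1)\<close>; the Lorentzian
  normal is \<open>(v, 1)\<close>, which for a unit vector \<open>v\<close> is itself a direction of the hyperplane.
\<close>

lemma light_like_hyperplane_graph_affine:
  fixes v :: "real ^ 'n"
  assumes "norm v = 1"
  shows "light_like_hyperplane (graph_over UNIV (\<lambda>x. b + (x - p) \<bullet> v))"
proof -
  define H where "H = graph_over UNIV (\<lambda>x. b + (x - p) \<bullet> v)"
  have H: "H = {z. (v, -1) \<bullet> z = p \<bullet> v - b}"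
    by (auto simp: H_def graph_over_def inner_prod_def inner_diff_left inner_diff_right
        inner_commute[of v])
  have V: "{z - w | z w. z \<in> H \<and> w \<in> H} = {z. (v, -1) \<bullet> z = 0}" (is "?V = _")
  proof (intro set_eqI iffI)
    fix z :: "(real ^ 'n) \<times> real" assume "z \<in> ?V"
    thus "z \<in> {z. (v, -1) \<bullet> z = 0}"
      unfolding H by (auto simp: inner_diff_right simp del: diff_Pair)
  next
    fix z :: "(real ^ 'n) \<times> real" assume "z \<in> {z. (v, -1) \<bullet> z = 0}"
    moreover have "(p, b) \<in> H" by (simp add: H inner_prod_def inner_commute)
    ultimately have "z = (z + (p, b)) - (p, b)" "z + (p, b) \<in> H" "(p, b) \<in> H"
      by (auto simp: H inner_add_right simp del: add_Pair)
    thus "z \<in> ?V" by blast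
  qed
  have vv: "v \<bullet> v = 1" using assms by (simp add: norm_eq_1)
  have "lorentz (v, 1) z = (v, -1) \<bullet> z" for z
    by (simp add: lorentz_def inner_prod_def inner_vec_def)
  hence "(v, 1) \<in> ?V \<and> (v, 1) \<noteq> 0 \<and> (\<forall>w\<in>?V. lorentz (v, 1) w = 0)"
    unfolding V using vv by (auto simp: zero_prod_def)
  moreover have "affine H" unfolding H by (rule affine_hyperplane)
  moreover have "aff_dim H = int DIM((real ^ 'n) \<times> real) - 1"
    unfolding H using aff_dim_hyperplane[of "(v, -1 :: real)" "p \<bullet> v - b"] DIM_positive
    by (auto simp: zero_prod_def of_nat_diff)
  ultimately show ?thesis
    unfolding light_like_hyperplane_def Let_def H_def[symmetric] by blast
qed

theorem corollaryC:
  fixes f :: "real ^ 'n \<Rightarrow> real"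
  assumes "CARD('n) \<ge> 2"
    and "real_analytic_on f UNIV"
    and "cmc_graph UNIV f"
    and "\<forall>x. \<not> time_like_point f x"
    and "\<exists>x. light_like_point f x"
  shows "light_like_hyperplane (graph_over UNIV f)"
proof -
  note f = assms(2)
  have B: "B_fun f x \<ge> 0" for x
    using assms(4) by (simp add: time_like_point_def not_less)
  obtain p where p: "B_fun f p = 0"
    using assms(5) by (auto simp: light_like_point_def)
  obtain k where k: "(A_fun f x)\<^sup>2 = k * B_fun f x ^ 3" for x
    using assms(3) by (auto simp: cmc_graph_def)
  define v where "v = (\<chi> i. partial_deriv i f p)"
  have v: "norm v = 1"
    using p by (simp add: v_def norm_vec_def L2_set_def B_fun_def)
  have "((\<lambda>t. f (p + t *\<^sub>R v) - t) has_real_derivative 0) (at t)" for t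
    using deriv_along_light_like_line[OF f B k p, of t]
    by (auto intro!: derivative_eq_intros real_analytic_deriv_along_line[OF f] simp: v_def)
  hence "f (p + t *\<^sub>R v) - t = f (p + 0 *\<^sub>R v) - 0" for t
    by (intro DERIV_isconst_all) auto
  hence "f (p + t *\<^sub>R v) = f p + t" for t
    by (simp add: diff_eq_eq)
  hence "f = (\<lambda>x. f p + (x - p) \<bullet> v)"
    using lipschitz_with_unit_slope_line_affine[OF real_analytic_lipschitz[OF f B] v] by blast
  thus ?thesis
    using light_like_hyperplane_graph_affine[OF v, of "f p" p] by simp
qed

end
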